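(* In the one-dimensional market $\mathcal{M}=\mathbb{R}$ with $q=0$, i.e. with aggregate prices $P_i\{x\}=P_i+(x-x_i)^2-\beta$, $\beta\ge0$, when the market is at a (pure strategy) Nash equilibrium, one has $$P_i=\frac{2d_i d_{i-1}}{d_i+d_{i-1}}\,S_i\qquad\text{for all } i\in\mathcal{N},$$ where $d_i=x_{i+1}-x_i$ and $S_i$ is the market area of company $i$ at the equilibrium.
   Context: Market: $\mathcal{M}=\mathbb{R}$; each point $x$ is a customer (uniform, unit density). $\mathcal{N}'$ is the (infinite) set of companies; company $k$ has fixed position $x_k\in\mathbb{R}$. Positions are distinct, every bounded interval contains finitely many companies, and there is $r<\infty$ such that every interval $(x_0-r,x_0+r)$ contains at least one company. For an arbitrarily chosen $B>0$, $\mathcal{N}=\{k\in\mathcal{N}' : x_k\in[-B/2,B/2]\}$, assumed nonempty (hence finite and nonempty). Only companies in $\mathcal{N}$ are players; every company $j\in\mathcal{N}'\setminus\mathcal{N}$ has a constant price $P_j\equiv P_{j0}\in[0,P_{upper}]$. Each player $i\in\mathcal{N}$ chooses a price $P_i\in[0,P_{upper}]$, where $P_{upper}$ is finite and sufficiently large (larger than some threshold depending on the market data). Aggregate price of company $i$ at customer $x$: $P_i\{x\}=P_i+(x-x_i)^2-\beta$. Owners of $x$: $\mathcal{O}'(x,\mathbf{P})=\operatorname{argmin}_{k\in\mathcal{N}'}P_k\{x\}$. Market area: $\mathcal{S}_i=\{x:\mathcal{O}'(x,\mathbf{P})=\{i\}\}$, $S_i=|\mathcal{S}_i|$ (length); company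 $i$ is surviving if $S_i>0$. Payoff of $i$: $W_i(\mathbf{P})=P_i\cdot S_i$. A price vector $\mathbf{P}^*$ is a Nash equilibrium if for each $i\in\mathcal{N}$, $P_i^*$ maximizes $P_i\mapsto W_i(P_i,P_{-i}^* )$ over $[0,P_{upper}]$. Indexing: surviving companies are labelled by consecutive integers in increasing order of coordinates, so $i-1$ and $i+1$ are the surviving companies immediately to the left and to the right of $i$.
   Formalization: The price formula is claimed for a player i only if every fixed-price company outside N that co-owns some customer with i is surviving; without this the formula can fail at a kink of the payoff when a zero-area outside company is tied with i at an endpoint of its market area. *)

theory Defs
  imports "HOL-Analysis.Analysis"
begin

text \<open>The set of all companies is the type \<open>'k\<close>; company \<open>k\<close> is located at \<open>pos k\<close> and charges
  \<open>P k\<close>.\<close>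

definition aggregate_price :: "('k \<Rightarrow> real) \<Rightarrow> real \<Rightarrow> ('k \<Rightarrow> real) \<Rightarrow> 'k \<Rightarrow> real \<Rightarrow> real" where
  "aggregate_price pos \<beta> P k x = P k + (x - pos k)\<^sup>2 - \<beta>"

definition owners :: "('k \<Rightarrow> real) \<Rightarrow> real \<Rightarrow> ('k \<Rightarrow> real) \<Rightarrow> real \<Rightarrow> 'k set" where
  "owners pos \<beta> P x = {k. is_arg_min (\<lambda>j. aggregate_price pos \<beta> P j x) (\<lambda>_. True) k}"

definition market_region :: "('k \<Rightarrow> real) \<Rightarrow> real \<Rightarrow> ('k \<Rightarrow> real) \<Rightarrow> 'k \<Rightarrow> real set" where
  "market_region pos \<beta> P i = {x. owners pos \<beta> P x = {i}}"

definition market_area :: "('k \<Rightarrow> real) \<Rightarrow> real \<Rightarrow> ('k \<Rightarrow> real) \<Rightarrow> 'k \<Rightarrow> real" where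
  "market_area pos \<beta> P i = measure lborel (market_region pos \<beta> P i)"

definition surviving :: "('k \<Rightarrow> real) \<Rightarrow> real \<Rightarrow> ('k \<Rightarrow> real) \<Rightarrow> 'k \<Rightarrow> bool" where
  "surviving pos \<beta> P i \<longleftrightarrow> market_area pos \<beta> P i > 0"

definition payoff :: "('k \<Rightarrow> real) \<Rightarrow> real \<Rightarrow> ('k \<Rightarrow> real) \<Rightarrow> 'k \<Rightarrow> real" where
  "payoff pos \<beta> P i = P i * market_area pos \<beta> P i"

definition players :: "('k \<Rightarrow> real) \<Rightarrow> real \<Rightarrow> 'k set" where
  "players pos B = {k. pos k \<in> {- B / 2..B / 2}}"

text \<open>\<open>Pupper\<close> is the price cap and \<open>P0\<close> gives the constant prices of the non-players; the values of
  \<open>P0\<close> on players are irrelevant.\<close>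

definition nash_equilibrium ::
  "('k \<Rightarrow> real) \<Rightarrow> real \<Rightarrow> real \<Rightarrow> real \<Rightarrow> ('k \<Rightarrow> real) \<Rightarrow> ('k \<Rightarrow> real) \<Rightarrow> bool" where
  "nash_equilibrium pos \<beta> B Pupper P0 P \<longleftrightarrow>
     (\<forall>j. j \<notin> players pos B \<longrightarrow> P j = P0 j) \<and>
     (\<forall>i \<in> players pos B. P i \<in> {0..Pupper}) \<and>
     (\<forall>i \<in> players pos B. \<forall>p \<in> {0..Pupper}. payoff pos \<beta> (P(i := p)) i \<le> payoff pos \<beta> P i)"

definition right_neighbour :: "('k \<Rightarrow> real) \<Rightarrow> real \<Rightarrow> ('k \<Rightarrow> real) \<Rightarrow> 'k \<Rightarrow> 'k \<Rightarrow> bool" where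
  "right_neighbour pos \<beta> P i j \<longleftrightarrow> surviving pos \<beta> P j \<and> pos i < pos j \<and>
     (\<forall>k. surviving pos \<beta> P k \<and> pos i < pos k \<longrightarrow> pos j \<le> pos k)"

definition left_neighbour :: "('k \<Rightarrow> real) \<Rightarrow> real \<Rightarrow> ('k \<Rightarrow> real) \<Rightarrow> 'k \<Rightarrow> 'k \<Rightarrow> bool" where
  "left_neighbour pos \<beta> P i j \<longleftrightarrow> surviving pos \<beta> P j \<and> pos j < pos i \<and>
     (\<forall>k. surviving pos \<beta> P k \<and> pos k < pos i \<longrightarrow> pos k \<le> pos j)"

text \<open>The next condition excludes a knife-edge configuration, in which a fixed-price company with
  zero market area is tied with player \<open>i\<close> at an endpoint of the market region of \<open>i\<close>.
  There the payoff of \<open>i\<close> has a kink at its maximum, and the first-order condition can fail.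
  Example: companies at all integers, \<open>B = 1\<close> (the only player is \<open>0\<close>), constant prices \<open>5\<close> at
  \<open>-1, 1\<close> and \<open>9/2\<close> elsewhere. For \<open>p\<close> near \<open>7/2\<close> the payoff of \<open>0\<close> is
  \<open>2 * p * min (3 - p/2) (17/8 - p/4)\<close>, maximal at the kink \<open>p = 7/2\<close>; companies \<open>-1\<close> and \<open>1\<close> then
  have area \<open>0\<close>, the surviving neighbours are \<open>-2\<close> and \<open>2\<close>, the area of \<open>0\<close> is \<open>5/2\<close>, and
  \<open>2 * (2 * 2 / (2 + 2)) * (5/2) = 5 \<noteq> 7/2\<close>.\<close>

definition no_marginal_outsider ::
  "('k \<Rightarrow> real) \<Rightarrow> real \<Rightarrow> real \<Rightarrow> ('k \<Rightarrow> real) \<Rightarrow> 'k \<Rightarrow> bool" where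
  "no_marginal_outsider pos \<beta> B P i \<longleftrightarrow>
     (\<forall>k x. k \<notin> players pos B \<and> i \<in> owners pos \<beta> P x \<and> k \<in> owners pos \<beta> P x
        \<longrightarrow> surviving pos \<beta> P k)"

end

theory Submission
  imports Defs
begin

text \<open>The difference of two aggregate prices is affine in the customer \<open>x\<close> with slope governed by the
  positions, so the set of customers that company \<open>i\<close> owns, possibly jointly, is a compact interval
  \<open>{a..b}\<close>, whose interior is the market region. A small positive price wins the customers next to
  the company, so every player survives at equilibrium. Hence all companies tied with \<open>i\<close> at \<open>a\<close> or
  \<open>b\<close> survive, and only the surviving neighbour on that side can be tied there. A price cut by a small
  \<open>e\<close> of either sign then moves the endpoints to \<open>a - e / (2 * d')\<close> and \<open>b + e / (2 * d)\<close>, and the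
  first-order condition for the payoff is the asserted formula. The price cap is not attained: at the
  cap the area of \<open>i\<close> is at most \<open>2 * r\<close> while the neighbours lie at distance \<open>O(sqrt Pupper)\<close>, so a
  price cut would pay.\<close>

section \<open>Ownership cells and affine price differences\<close>

definition cell :: "('k \<Rightarrow> real) \<Rightarrow> ('k \<Rightarrow> real) \<Rightarrow> 'k \<Rightarrow> real set" where
  "cell pos P i = {x. \<forall>k. P i + (x - pos i)\<^sup>2 \<le> P k + (x - pos k)\<^sup>2}"

lemma owners_iff_cell: "i \<in> owners pos \<beta> P x \<longleftrightarrow> x \<in> cell pos P i"
  by (auto simp: owners_def cell_def is_arg_min_def aggregate_price_def not_less)

lemma market_region_iff:
  "x \<in> market_region pos \<beta> P i \<longleftrightarrow> (\<forall>k. k \<noteq> i \<longrightarrow> P i + (x - pos i)\<^sup>2 < P k + (x - pos k)\<^sup>2)"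
proof
  assume "x \<in> market_region pos \<beta> P i"
  then have o: "owners pos \<beta> P x = {i}"
    by (simp add: market_region_def)
  then have i: "x \<in> cell pos P i"
    using owners_iff_cell by fast
  show "\<forall>k. k \<noteq> i \<longrightarrow> P i + (x - pos i)\<^sup>2 < P k + (x - pos k)\<^sup>2"
  proof (intro allI impI)
    fix k assume "k \<noteq> i"
    \<comment> \<open>This only yields some \<open>j\<close> cheaper than \<open>k\<close> at
      \<open>x\<close>; the owner \<open>i\<close> costs at most as much as
      \<open>j\<close>.\<close>
    then have "x \<notin> cell pos P k"
      using o owners_iff_cell by fast
    then obtain j where "P j + (x - pos j)\<^sup>2 < P k + (x - pos k)\<^sup>2"
      by (auto simp: cell_def not_le)
    moreover have "P i + (x - pos i)\<^sup>2 \<le> P j + (x - pos j)\<^sup>2"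
      using i by (simp add: cell_def)
    ultimately show "P i + (x - pos i)\<^sup>2 < P k + (x - pos k)\<^sup>2"
      by linarith
  qed
next
  assume *: "\<forall>k. k \<noteq> i \<longrightarrow> P i + (x - pos i)\<^sup>2 < P k + (x - pos k)\<^sup>2"
  have "i \<in> owners pos \<beta> P x"
    unfolding owners_iff_cell cell_def
  proof safe
    fix k show "P i + (x - pos i)\<^sup>2 \<le> P k + (x - pos k)\<^sup>2"
      using * by (cases "k = i") (auto intro: less_imp_le)
  qed
  moreover have "k \<notin> owners pos \<beta> P x" if "k \<noteq> i" for k
    unfolding owners_iff_cell cell_def using * that by (auto simp: not_le)
  ultimately show "x \<in> market_region pos \<beta> P i"
    unfolding market_region_def by blast
qed

text \<open>Mirroring the line lets statements about right ends be transferred to left ends.\<close>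

lemma cell_uminus: "x \<in> cell (\<lambda>k. - pos k) P i \<longleftrightarrow> - x \<in> cell pos P i"
proof -
  have "(x - - pos k)\<^sup>2 = (- x - pos k)\<^sup>2" for k
    by (simp add: power2_eq_square algebra_simps)
  then show ?thesis
    by (simp add: cell_def)
qed

lemma price_diff_affine:
  fixes x :: real
  shows "(p + (x - u)\<^sup>2) - (q + (x - v)\<^sup>2) = (p - q + u\<^sup>2 - v\<^sup>2) - 2 * (u - v) * x"
  by (simp add: power2_eq_square algebra_simps)

text \<open>An affine function on an interval is smallest at an endpoint. The shape
  \<open>c - m * x\<close> matches \<open>price_diff_affine\<close>.\<close>

lemma affine_greater_between:
  fixes c m x y z :: real
  assumes "e < c - m * x" "e < c - m * z" "x \<le> y" "y \<le> z"
  shows "e < c - m * y"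
proof (cases "m \<ge> 0")
  case True
  then have "m * y \<le> m * z"
    using assms by (simp add: mult_left_mono)
  then show ?thesis
    using assms by linarith
next
  case False
  then have "m * y \<le> m * x"
    using assms by (simp add: mult_left_mono_neg)
  then show ?thesis
    using assms by linarith
qed

section \<open>Geometry of cells for a fixed price vector\<close>

text \<open>Positions and prices are parameters, so that the locale can be reused for mirrored
  positions and for a changed price.\<close>

locale market =
  fixes pos P :: "'k \<Rightarrow> real" and r M :: real
  assumes inj: "inj pos"
    and locally_finite: "\<And>a b. finite {k. pos k \<in> {a..b}}"
    and relatively_dense: "\<And>x. \<exists>k. pos k \<in> {x - r<..<x + r}"
    and price_nonneg: "\<And>k. 0 \<le> P k"
    and price_le: "\<And>k. P k \<le> M"
begin

abbreviation f :: "'k \<Rightarrow> real \<Rightarrow> real" where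
  "f k x \<equiv> P k + (x - pos k)\<^sup>2"

abbreviation C :: "'k \<Rightarrow> real set" where
  "C \<equiv> cell pos P"

lemma pos_eq_iff [simp]: "pos i = pos k \<longleftrightarrow> i = k"
  using inj by (simp add: inj_eq)

lemma reflected: "market (\<lambda>k. - pos k) P r M"
proof
  show "inj (\<lambda>k. - pos k)"
    by (simp add: inj_def)
  show "finite {k. - pos k \<in> {a..b}}" for a b
    using locally_finite[of "-b" "-a"] by (rule rev_finite_subset) auto
  show "\<exists>k. - pos k \<in> {x - r<..<x + r}" for x
  proof -
    obtain k where "pos k \<in> {- x - r<..<- x + r}"
      using relatively_dense by blast
    then show ?thesis
      by (intro exI[of _ k]) auto
  qed
qed (use price_nonneg price_le in auto)

lemma reprice: "0 \<le> p \<Longrightarrow> p \<le> M \<Longrightarrow> market pos (P(i := p)) r M"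
  using market_axioms by (auto simp: market_def)

lemma r_pos: "r > 0"
  using relatively_dense[of 0] by auto

lemma M_nonneg: "M \<ge> 0"
  using price_nonneg price_le order_trans by blast

text \<open>Some rival lies within \<open>r\<close> of \<open>x\<close> and charges at most
  \<open>M\<close>.\<close>

lemma cell_dist:
  assumes "x \<in> C i"
  shows "(x - pos i)\<^sup>2 \<le> M - P i + r\<^sup>2"
proof -
  obtain k where k: "pos k \<in> {x - r<..<x + r}"
    using relatively_dense by blast
  then have "\<bar>x - pos k\<bar> \<le> \<bar>r\<bar>"
    by auto
  then have "(x - pos k)\<^sup>2 \<le> r\<^sup>2"
    by (simp add: abs_le_square_iff)
  moreover have "f i x \<le> f k x"
    using assms by (simp add: cell_def)
  ultimately show ?thesis
    using price_le[of k] by linarith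
qed

lemma cell_dist_abs:
  assumes "x \<in> C i"
  shows "\<bar>x - pos i\<bar> \<le> M + r + 1"
proof -
  have "(x - pos i)\<^sup>2 \<le> M + r\<^sup>2"
    using cell_dist[OF assms] price_nonneg[of i] by linarith
  also have "\<dots> \<le> (M + r + 1)\<^sup>2"
    using M_nonneg r_pos by (simp add: power2_eq_square algebra_simps)
  finally show ?thesis
    using M_nonneg r_pos by (simp add: abs_le_square_iff[symmetric])
qed

text \<open>Each comparison with a rival cuts out a closed convex set, and
  \<open>cell_dist_abs\<close> bounds the intersection. An empty cell is covered by
  \<open>b < a\<close>.\<close>

lemma cell_interval: "\<exists>a b. C i = {a..b}"
proof -
  have eq: "C i = (\<Inter>k. {x. f i x \<le> f k x})"
    by (auto simp: cell_def)
  have cl: "closed (C i)"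
    unfolding eq by (intro closed_INT ballI closed_Collect_le continuous_intros)
  have "convex {x. f i x \<le> f k x}" for k
  proof -
    have "f i x \<le> f k x \<longleftrightarrow> 2 * (pos k - pos i) * x \<le> P k - P i + (pos k)\<^sup>2 - (pos i)\<^sup>2" for x
      using price_diff_affine[of "P k" x "pos k" "P i" "pos i"] by auto
    then show ?thesis
      using convex_halfspace_le[of "2 * (pos k - pos i)" "P k - P i + (pos k)\<^sup>2 - (pos i)\<^sup>2"]
      by simp
  qed
  then have cv: "convex (C i)"
    unfolding eq by (intro convex_INT)
  have "C i \<subseteq> cball (pos i) (M + r + 1)"
    using cell_dist_abs by (auto simp: dist_real_def abs_minus_commute)
  then have "bounded (C i)"
    using bounded_cball bounded_subset by blast
  then show ?thesis
    using cl cv connected_compact_interval_1 convex_connected compact_eq_bounded_closed by metis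
qed

text \<open>The difference \<open>f k - f i\<close> is strictly decreasing, nonnegative at
  \<open>x\<close> and nonpositive at \<open>y\<close>.\<close>

lemma cell_order:
  assumes "pos i < pos k" "x \<in> C i" "y \<in> C k"
  shows "x \<le> y"
proof -
  have "0 \<le> f k x - f i x" "f k y - f i y \<le> 0"
    using assms by (auto simp: cell_def)
  then have "2 * (pos k - pos i) * x \<le> 2 * (pos k - pos i) * y"
    unfolding price_diff_affine by linarith
  then show ?thesis
    using assms(1) by simp
qed

lemma finitely_many_relevant: "finite {k. \<exists>x. \<bar>x\<bar> \<le> R \<and> f k x \<le> c}"
proof (rule rev_finite_subset[OF locally_finite[of "- R - \<bar>c\<bar> - 1" "R + \<bar>c\<bar> + 1"]], safe)
  fix k x assume x: "\<bar>x\<bar> \<le> R" and le: "f k x \<le> c"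
  have "(x - pos k)\<^sup>2 \<le> \<bar>c\<bar>"
    using le price_nonneg[of k] by linarith
  also have "\<dots> \<le> (\<bar>c\<bar> + 1)\<^sup>2"
    by (simp add: power2_eq_square algebra_simps)
  finally have "\<bar>x - pos k\<bar> \<le> \<bar>c\<bar> + 1"
    by (simp add: abs_le_square_iff[symmetric])
  then show "pos k \<in> {- R - \<bar>c\<bar> - 1..R + \<bar>c\<bar> + 1}"
    using x by auto
qed

text \<open>Continuity gives a margin for each single rival. It can be chosen uniformly because only
  finitely many rivals come below a fixed price level near \<open>b\<close>.\<close>

lemma uniform_margin:
  assumes "\<And>k. k \<in> K \<Longrightarrow> f i b < f k b"
  shows "\<exists>\<eta>>0. \<forall>k\<in>K. \<forall>x. \<bar>x - b\<bar> \<le> \<eta> \<longrightarrow> f i x + \<eta> < f k x"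
proof -
  \<comment> \<open>Bounds \<open>f i x + \<eta>\<close> whenever
    \<open>\<bar>x - b\<bar> \<le> \<eta> < 1\<close>, so rivals outside \<open>F\<close> need no
    further estimate.\<close>
  define c where "c = P i + (\<bar>b - pos i\<bar> + 1)\<^sup>2 + 1"
  define F where "F = {k. \<exists>x. \<bar>x\<bar> \<le> \<bar>b\<bar> + 1 \<and> f k x \<le> c}"
  have "finite (F \<inter> K)"
    unfolding F_def using finitely_many_relevant by blast
  moreover have "\<forall>\<^sub>F \<eta> in at_right 0. \<forall>x. \<bar>x - b\<bar> \<le> \<eta> \<longrightarrow> f i x + \<eta> < f k x" if "k \<in> F \<inter> K" for k
  proof -
    define D where "D = f k b - f i b"
    \<comment> \<open>The slope of \<open>f k - f i\<close> has absolute value \<open>m - 1\<close>;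
      the extra 1 pays for the margin \<open>\<eta>\<close> itself.\<close>
    define m where "m = 1 + 2 * \<bar>pos k - pos i\<bar>"
    have "D > 0" "m > 0"
      using assms that by (auto simp: D_def m_def intro: add_pos_nonneg)
    then have "\<forall>\<^sub>F \<eta> in at_right 0. \<eta> < D / m"
      by (intro eventually_at_right_less[THEN eventually_mono] order_tendstoD(2)[OF tendsto_ident_at]) auto
    then show ?thesis
    proof eventually_elim
      case (elim \<eta>)
      then have \<eta>: "\<eta> * m < D"
        using \<open>m > 0\<close> by (simp add: pos_less_divide_eq)
      show ?case
      proof (intro allI impI)
        fix x assume x: "\<bar>x - b\<bar> \<le> \<eta>"
        have "2 * (pos k - pos i) * (x - b) \<le> \<bar>2 * (pos k - pos i) * (x - b)\<bar>"
          by (rule abs_ge_self)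
        also have "\<dots> = (2 * \<bar>pos k - pos i\<bar>) * \<bar>x - b\<bar>"
          unfolding abs_mult by simp
        also have "\<dots> \<le> (2 * \<bar>pos k - pos i\<bar>) * \<eta>"
          using x by (intro mult_left_mono) auto
        finally have "2 * (pos k - pos i) * (x - b) \<le> \<eta> * m - \<eta>"
          by (simp add: m_def algebra_simps)
        moreover have "f k x - f i x = D - 2 * (pos k - pos i) * (x - b)"
          unfolding D_def price_diff_affine by (simp add: algebra_simps)
        ultimately show "f i x + \<eta> < f k x"
          using \<eta> by linarith
      qed
    qed
  qed
  ultimately have "\<forall>\<^sub>F \<eta> in at_right 0. \<forall>k\<in>F \<inter> K. \<forall>x. \<bar>x - b\<bar> \<le> \<eta> \<longrightarrow> f i x + \<eta> < f k x"
    by (simp add: eventually_ball_finite)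
  moreover have "\<forall>\<^sub>F \<eta> in at_right (0::real). 0 < \<eta> \<and> \<eta> < 1"
    by (auto simp: eventually_at_right[of 0 1] intro: exI[of _ 1])
  ultimately have "\<forall>\<^sub>F \<eta> in at_right 0. \<eta> > 0 \<and> (\<forall>k\<in>K. \<forall>x. \<bar>x - b\<bar> \<le> \<eta> \<longrightarrow> f i x + \<eta> < f k x)"
  proof eventually_elim
    case (elim \<eta>)
    have "f i x + \<eta> < f k x" if k: "k \<in> K" and x: "\<bar>x - b\<bar> \<le> \<eta>" for k x
    proof (cases "k \<in> F")
      case True
      then show ?thesis
        using elim k x by blast
    next
      case False
      have "\<bar>x\<bar> \<le> \<bar>b\<bar> + 1"
        using x elim by linarith
      then have "c < f k x"
        using False unfolding F_def by (simp only: mem_Collect_eq) (meson not_le)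
      moreover have "\<bar>x - pos i\<bar> \<le> \<bar>\<bar>b - pos i\<bar> + 1\<bar>"
        using x elim by linarith
      then have "(x - pos i)\<^sup>2 \<le> (\<bar>b - pos i\<bar> + 1)\<^sup>2"
        by (simp only: abs_le_square_iff)
      ultimately show ?thesis
        using elim by (simp add: c_def)
    qed
    then show ?case
      using elim by blast
  qed
  then show ?thesis
    using eventually_happens[of _ "at_right (0::real)"] by fastforce
qed

section \<open>Market regions, areas and survival\<close>

text \<open>Strict inequalities persist nearby by \<open>uniform_margin\<close>. Conversely, a
  nonconstant affine difference that is nonnegative on both sides of \<open>x\<close> is positive at
  \<open>x\<close>.\<close>

lemma market_region_eq: "market_region pos \<beta> P i = interior (C i)"
proof (intro set_eqI iffI)
  fix x assume "x \<in> market_region pos \<beta> P i"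
  then have "f i x < f k x" if "k \<in> - {i}" for k
    using that by (simp add: market_region_iff)
  then obtain \<eta> where \<eta>: "\<eta> > 0" "\<forall>k\<in>- {i}. \<forall>y. \<bar>y - x\<bar> \<le> \<eta> \<longrightarrow> f i y + \<eta> < f k y"
    using uniform_margin by metis
  have "ball x \<eta> \<subseteq> C i"
  proof
    fix y assume "y \<in> ball x \<eta>"
    then have "\<bar>y - x\<bar> \<le> \<eta>"
      by (simp add: dist_real_def)
    then have "f i y \<le> f k y" for k
      using \<eta> by (cases "k = i") force+
    then show "y \<in> C i"
      by (simp add: cell_def)
  qed
  then show "x \<in> interior (C i)"
    using \<eta>(1) mem_interior by blast
next
  fix x assume "x \<in> interior (C i)"
  then obtain e where e: "e > 0" "ball x e \<subseteq> C i"
    using mem_interior by blast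
  have "x + e/2 \<in> C i" "x - e/2 \<in> C i"
    using e by (auto simp: dist_real_def subset_iff)
  then have le: "0 \<le> f k (x + e/2) - f i (x + e/2)" "0 \<le> f k (x - e/2) - f i (x - e/2)" for k
    by (auto simp: cell_def)
  have "f i x < f k x" if "k \<noteq> i" for k
  proof -
    have "pos k < pos i \<or> pos i < pos k"
      using that by (meson linorder_neqE_linordered_idom pos_eq_iff)
    then have "(pos k - pos i) * e > 0 \<or> (pos k - pos i) * e < 0"
      using e by (auto simp: zero_less_mult_iff mult_less_0_iff)
    then have "0 < f k x - f i x"
      using le[of k] unfolding price_diff_affine by (auto simp: algebra_simps)
    then show ?thesis
      by simp
  qed
  then show "x \<in> market_region pos \<beta> P i"
    by (simp add: market_region_iff)
qed

lemma market_region_interval: "C i = {a..b} \<Longrightarrow> market_region pos \<beta> P i = {a<..<b}"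
  by (simp add: market_region_eq)

lemma market_area_eq: "C i = {a..b} \<Longrightarrow> market_area pos \<beta> P i = max 0 (b - a)"
  unfolding market_area_def market_region_interval by (cases "a \<le> b") auto

text \<open>Optimality arguments only need lower bounds on the area after a price change.\<close>

lemma market_area_ge:
  assumes "{a<..<b} \<subseteq> market_region pos \<beta> P i"
  shows "b - a \<le> market_area pos \<beta> P i"
proof -
  obtain a' b' where *: "C i = {a'..b'}"
    using cell_interval by blast
  then show ?thesis
    using assms market_area_eq[OF *]
    by (auto simp: market_region_interval[OF *] greaterThanLessThan_subseteq_greaterThanLessThan)
qed

lemma surviving_iff: "surviving pos \<beta> P i \<longleftrightarrow> (\<exists>x y. x < y \<and> x \<in> C i \<and> y \<in> C i)"
proof -
  obtain a b where *: "C i = {a..b}"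
    using cell_interval by blast
  show ?thesis
    unfolding surviving_def market_area_eq[OF *] *
    by (auto simp: less_max_iff_disj) (metis less_imp_le order_refl)
qed

lemma surviving_cellE:
  assumes "surviving pos \<beta> P i"
  obtains a b where "C i = {a..b}" "a < b"
  using cell_interval[of i] assms unfolding surviving_iff by force

section \<open>Existence of surviving neighbours\<close>

lemma cells_cover: "\<exists>k. x \<in> C k"
proof -
  obtain k0 :: 'k where True
    by simp
  define F where "F = {k. f k x \<le> f k0 x}"
  have "finite F"
    by (rule rev_finite_subset[OF finitely_many_relevant[of "\<bar>x\<bar>" "f k0 x"]]) (auto simp: F_def)
  moreover have "F \<noteq> {}"
    by (auto simp: F_def)
  ultimately obtain k where k: "k \<in> F" "\<And>j. j \<in> F \<Longrightarrow> f k x \<le> f j x"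
    using ex_min_if_finite[of "(\<lambda>k. f k x) ` F"] by (fastforce simp: not_less)
  have "f k x \<le> f j x" for j
    using k(1) k(2)[of j] by (cases "j \<in> F") (auto simp: F_def)
  then show ?thesis
    by (auto simp: cell_def)
qed

text \<open>Cells of non-surviving companies have at most one point, and finitely many of them
  cannot cover an interval of length 1.\<close>

lemma right_survivor_exists: "\<exists>k. surviving pos \<beta> P k \<and> pos i < pos k"
proof (rule ccontr)
  assume none: "\<nexists>k. surviving pos \<beta> P k \<and> pos i < pos k"
  \<comment> \<open>By \<open>cell_dist_abs\<close>, a cell meeting \<open>{y..y+1}\<close> belongs
    to a company at least 1 to the right of \<open>i\<close>.\<close>
  define y where "y = pos i + M + r + 2"
  define F where "F = {k. \<exists>x\<in>{y..y+1}. x \<in> C k}"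
  have near: "pos k \<in> {pos i + 1..y + 1 + M + r + 1}" if k: "k \<in> F" for k
  proof -
    obtain x where "x \<in> {y..y+1}" "x \<in> C k"
      using k unfolding F_def by blast
    then show ?thesis
      using cell_dist_abs[of x k] by (auto simp: y_def)
  qed
  then have "finite F"
    by (intro rev_finite_subset[OF locally_finite]) blast
  moreover have "finite (C k)" if "k \<in> F" for k
  proof -
    have "\<not> surviving pos \<beta> P k"
      using none near[OF that] by force
    moreover obtain a b where C: "C k = {a..b}"
      using cell_interval by blast
    ultimately have "\<not> a < b"
      unfolding surviving_iff by (metis atLeastAtMost_iff less_imp_le order_refl)
    then show ?thesis
      unfolding C by (cases "a = b") auto
  qed
  ultimately have "finite (\<Union>k\<in>F. C k)"
    by simp
  moreover have "{y..y+1} \<subseteq> (\<Union>k\<in>F. C k)"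
    unfolding F_def using cells_cover by blast
  ultimately have "finite {y..y+1}"
    using finite_subset by blast
  then show False
    by (simp add: infinite_Icc)
qed

lemma right_neighbour_exists: "\<exists>u. right_neighbour pos \<beta> P i u"
proof -
  obtain k0 where k0: "surviving pos \<beta> P k0" "pos i < pos k0"
    using right_survivor_exists by blast
  define F where "F = {k. surviving pos \<beta> P k \<and> pos i < pos k \<and> pos k \<le> pos k0}"
  have "finite F"
    by (rule rev_finite_subset[OF locally_finite[of "pos i" "pos k0"]]) (auto simp: F_def)
  moreover have "F \<noteq> {}"
    using k0 by (auto simp: F_def)
  ultimately obtain u where u: "u \<in> F" "\<And>j. j \<in> F \<Longrightarrow> pos u \<le> pos j"
    using ex_min_if_finite[of "pos ` F"] by (fastforce simp: not_less)
  have "pos u \<le> pos k" if "surviving pos \<beta> P k" "pos i < pos k" for k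
    using u that by (cases "pos k \<le> pos k0") (auto simp: F_def)
  then show ?thesis
    using u(1) by (auto simp: right_neighbour_def F_def)
qed

section \<open>Companies tied at the ends of a cell\<close>

text \<open>By \<open>cell_order\<close>, companies on the left own nothing beyond \<open>a\<close>.
  Without a tie on the right, \<open>b\<close> would lie in the open market region.\<close>

lemma right_end_tied:
  assumes "C i = {a..b}" "a < b"
  shows "\<exists>k. pos i < pos k \<and> b \<in> C k"
proof (rule ccontr)
  assume none: "\<nexists>k. pos i < pos k \<and> b \<in> C k"
  have b: "b \<in> C i"
    using assms by simp
  have "f i b < f k b" if "k \<noteq> i" for k
  proof (rule ccontr)
    assume "\<not> f i b < f k b"
    then have "b \<in> C k"
      using b unfolding cell_def by (auto simp: not_less) (meson order_trans)
    then have "pos k < pos i"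
      using none that by (meson linorder_neqE_linordered_idom pos_eq_iff)
    then show False
      using cell_order[of k i b a] \<open>b \<in> C k\<close> assms by simp
  qed
  then have "b \<in> market_region pos 0 P i"
    by (simp add: market_region_iff)
  then show False
    using assms by (simp add: market_region_interval)
qed

text \<open>A tied company beyond \<open>u\<close> would squeeze the cell of \<open>u\<close>
  between two cells containing \<open>b\<close>, leaving at most the point \<open>b\<close>.\<close>

lemma right_end_owners:
  assumes C: "C i = {a..b}" "a < b"
    and u: "right_neighbour pos \<beta> P i u"
    and surv: "\<And>k. b \<in> C k \<Longrightarrow> surviving pos \<beta> P k"
  shows "b \<in> C k \<longleftrightarrow> k = i \<or> k = u"
proof -
  have right: "k = u" if k: "pos i < pos k" "b \<in> C k" for k
  proof (rule ccontr)
    assume "k \<noteq> u"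
    moreover have "pos u \<le> pos k"
      using u surv[OF k(2)] k(1) by (auto simp: right_neighbour_def)
    ultimately have "pos u < pos k"
      by (simp add: less_le)
    moreover have "pos i < pos u" "surviving pos \<beta> P u"
      using u by (auto simp: right_neighbour_def)
    moreover have "b \<in> C i"
      using C by simp
    ultimately have "y = b" if "y \<in> C u" for y
      using that k(2) cell_order by (meson antisym)
    then show False
      using \<open>surviving pos \<beta> P u\<close> unfolding surviving_iff by (metis less_irrefl)
  qed
  have "\<not> pos k < pos i" if "b \<in> C k" for k
    using cell_order[of k i b a] that C by auto
  then have "k = i \<or> k = u" if "b \<in> C k" for k
    using right that by (meson linorder_neqE_linordered_idom pos_eq_iff)
  moreover have "b \<in> C u"
    using right right_end_tied[OF C] by blast
  ultimately show ?thesis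
    using C by auto
qed

lemma surviving_reflected: "surviving (\<lambda>k. - pos k) \<beta> P = surviving pos \<beta> P"
proof
  fix k
  interpret R: market "\<lambda>k. - pos k" P r M
    by (rule reflected)
  show "surviving (\<lambda>k. - pos k) \<beta> P k = surviving pos \<beta> P k"
    unfolding surviving_iff R.surviving_iff cell_uminus
    by (metis minus_minus neg_less_iff_less)
qed

lemma left_neighbour_iff:
  "left_neighbour pos \<beta> P i l \<longleftrightarrow> right_neighbour (\<lambda>k. - pos k) \<beta> P i l"
  by (simp add: left_neighbour_def right_neighbour_def surviving_reflected)

lemma left_neighbour_exists: "\<exists>l. left_neighbour pos \<beta> P i l"
  unfolding left_neighbour_iff using market.right_neighbour_exists[OF reflected] .

lemma left_end_owners:
  assumes "C i = {a..b}" "a < b" "left_neighbour pos \<beta> P i l"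
    and "\<And>k. a \<in> C k \<Longrightarrow> surviving pos \<beta> P k"
  shows "a \<in> C k \<longleftrightarrow> k = i \<or> k = l"
proof -
  have "cell (\<lambda>k. - pos k) P i = {- b..- a}"
    using assms(1) by (auto simp: cell_uminus)
  then have "- a \<in> cell (\<lambda>k. - pos k) P k \<longleftrightarrow> k = i \<or> k = l"
    using assms by (intro market.right_end_owners[OF reflected, of i "- b" "- a" \<beta> l k])
      (auto simp: cell_uminus left_neighbour_iff surviving_reflected)
  then show ?thesis
    by (simp add: cell_uminus)
qed

section \<open>Effects of changing one price\<close>

lemma price_less_if_not_owner: "x \<in> C i \<Longrightarrow> x \<notin> C k \<Longrightarrow> f i x < f k x"
  unfolding cell_def by (auto simp: not_le) (meson le_less_trans not_le)

text \<open>Against the tied neighbours the price differences are explicit and give the new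
  endpoints. All other rivals lose by a margin at both new endpoints, hence also in between.
  Negative \<open>e\<close> is a price rise.\<close>

lemma region_after_price_cut:
  assumes C: "C i = {a..b}" "a < b"
    and l: "pos l < pos i" and u: "pos i < pos u"
    and ownl: "\<And>k. a \<in> C k \<longleftrightarrow> k = i \<or> k = l"
    and ownu: "\<And>k. b \<in> C k \<longleftrightarrow> k = i \<or> k = u"
  shows "\<exists>\<eta>>0. \<forall>e. \<bar>e\<bar> < \<eta> \<longrightarrow>
    {a - e / (2 * (pos i - pos l))<..<b + e / (2 * (pos u - pos i))}
      \<subseteq> market_region pos \<beta> (P(i := P i - e)) i"
proof -
  define d where "d = pos u - pos i"
  define d' where "d' = pos i - pos l"
  have d: "d > 0" "d' > 0"
    using l u by (auto simp: d_def d'_def)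
  have "a \<in> C i" "b \<in> C i"
    using C by auto
  have "f i b < f k b" if "k \<in> - {i, u}" for k
    using that ownu \<open>b \<in> C i\<close> by (auto intro!: price_less_if_not_owner)
  then obtain \<eta>1 where \<eta>1: "\<eta>1 > 0" "\<forall>k\<in>- {i, u}. \<forall>x. \<bar>x - b\<bar> \<le> \<eta>1 \<longrightarrow> f i x + \<eta>1 < f k x"
    using uniform_margin by metis
  have "f i a < f k a" if "k \<in> - {i, l}" for k
    using that ownl \<open>a \<in> C i\<close> by (auto intro!: price_less_if_not_owner)
  then obtain \<eta>2 where \<eta>2: "\<eta>2 > 0" "\<forall>k\<in>- {i, l}. \<forall>x. \<bar>x - a\<bar> \<le> \<eta>2 \<longrightarrow> f i x + \<eta>2 < f k x"
    using uniform_margin by metis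
  have "b \<in> C u" "a \<in> C l"
    using ownl ownu by auto
  then have tie: "f u b - f i b = 0" "f l a - f i a = 0"
    using \<open>a \<in> C i\<close> \<open>b \<in> C i\<close> by (auto simp: cell_def intro: antisym)
  have fu: "f u x - f i x = 2 * d * (b - x)" for x
    using tie(1) unfolding price_diff_affine d_def by (simp add: algebra_simps)
  have fl: "f l x - f i x = 2 * d' * (x - a)" for x
    using tie(2) unfolding price_diff_affine d'_def by (simp add: algebra_simps)
  \<comment> \<open>The first two entries keep \<open>e\<close> below the margins; the last two keep
    the moved endpoints where these margins hold.\<close>
  define \<eta> where "\<eta> = Min {\<eta>1, \<eta>2, 2 * d * \<eta>1, 2 * d' * \<eta>2}"
  have "\<eta> > 0"
    using d \<eta>1 \<eta>2 by (simp add: \<eta>_def)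
  moreover have "x \<in> market_region pos \<beta> (P(i := P i - e)) i"
    if e: "\<bar>e\<bar> < \<eta>" and x: "a - e / (2 * d') < x" "x < b + e / (2 * d)" for e x
  proof -
    have e': "\<bar>e\<bar> < \<eta>1" "\<bar>e\<bar> < \<eta>2" "\<bar>e\<bar> < 2 * d * \<eta>1" "\<bar>e\<bar> < 2 * d' * \<eta>2"
      using e by (auto simp: \<eta>_def)
    have eb: "\<bar>e / (2 * d)\<bar> \<le> \<eta>1" and ea: "\<bar>e / (2 * d')\<bar> \<le> \<eta>2"
      using e' d by (auto simp: field_simps)
    have "P i - e + (x - pos i)\<^sup>2 < f k x" if k: "k \<noteq> i" for k
    proof -
      consider "k = u" | "k = l" | "k \<notin> {i, u, l}"
        using k by blast
      then have "- e < f k x - f i x"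
      proof cases
        case 1
        have "2 * d * x < 2 * d * b + e"
          using x(2) d by (simp add: field_simps)
        then show ?thesis
          unfolding 1 fu by (simp add: algebra_simps)
      next
        case 2
        have "2 * d' * a - e < 2 * d' * x"
          using x(1) d by (simp add: field_simps)
        then show ?thesis
          unfolding 2 fl by (simp add: algebra_simps)
      next
        case 3
        have "f i (b + e / (2 * d)) + \<eta>1 < f k (b + e / (2 * d))"
          using 3 eb \<eta>1(2) by simp
        moreover have "f i (a - e / (2 * d')) + \<eta>2 < f k (a - e / (2 * d'))"
          using 3 ea \<eta>2(2) by simp
        ultimately have
          "- e < f k (a - e / (2 * d')) - f i (a - e / (2 * d'))"
          "- e < f k (b + e / (2 * d)) - f i (b + e / (2 * d))"
          using e'(1,2) by linarith+
        then show ?thesis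
          unfolding price_diff_affine using x
          by (rule affine_greater_between[OF _ _ less_imp_le less_imp_le])
      qed
      then show ?thesis
        by linarith
    qed
    then show ?thesis
      by (simp add: market_region_iff)
  qed
  ultimately show ?thesis
    unfolding d_def d'_def by (intro exI[of _ \<eta>]) auto
qed

text \<open>At the cap \<open>M\<close> the company serves only customers to which it is the nearest one.\<close>

lemma cell_near_at_cap:
  assumes "x \<in> C i" "P i = M"
  shows "\<bar>x - pos i\<bar> \<le> r"
proof -
  have "(x - pos i)\<^sup>2 \<le> r\<^sup>2"
    using cell_dist[OF assms(1)] assms(2) by simp
  then show ?thesis
    using r_pos by (simp add: abs_le_square_iff[symmetric])
qed

text \<open>The bound \<open>foc\<close> follows from price cuts alone, so it is available even at
  the cap, where it forces \<open>M \<le> 24 * r\<^sup>2\<close>.\<close>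

lemma below_cap:
  assumes "C i = {a..b}" "a < b" "b \<in> C u" "pos i < pos u"
    and M: "M > 24 * r\<^sup>2"
    and foc: "P i \<le> 2 * (pos u - pos i) * (b - a)"
  shows "P i < M"
proof (rule ccontr)
  assume "\<not> P i < M"
  then have cap: "P i = M"
    using price_le[of i] by simp
  have a: "\<bar>a - pos i\<bar> \<le> r" and b: "\<bar>b - pos i\<bar> \<le> r"
    using assms(1,2) cell_near_at_cap[OF _ cap] by auto
  define t where "t = \<bar>pos u - b\<bar>"
  have "t\<^sup>2 \<le> M + r\<^sup>2"
    using cell_dist[OF assms(3)] price_nonneg[of u] by (simp add: t_def power2_commute)
  moreover have "M \<le> 2 * (t + r) * (2 * r)"
  proof -
    have "M \<le> 2 * (pos u - pos i) * (b - a)"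
      using foc cap by simp
    also have "\<dots> \<le> 2 * (t + r) * (2 * r)"
      using a b assms(2,4) by (intro mult_mono) (auto simp: t_def)
    finally show ?thesis .
  qed
  \<comment> \<open>Eliminating \<open>M\<close> gives
    \<open>t\<^sup>2 \<le> 4 * r * (t + r) + r\<^sup>2\<close>, which factors.\<close>
  ultimately have "(t - 5 * r) * (t + r) \<le> 0"
    by (simp add: power2_eq_square algebra_simps)
  then have "t \<le> 5 * r"
    using r_pos by (auto simp: mult_le_0_iff t_def)
  then have "2 * (t + r) * (2 * r) \<le> 2 * (5 * r + r) * (2 * r)"
    using r_pos by (intro mult_right_mono) auto
  also have "\<dots> = 24 * r\<^sup>2"
    by (simp add: power2_eq_square)
  finally show False
    using M \<open>M \<le> 2 * (t + r) * (2 * r)\<close> by linarith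
qed

text \<open>At price 0 company \<open>i\<close> strictly beats every rival at its own location, and
  the uniform margin there absorbs a small positive price.\<close>

lemma profitable_price_exists:
  assumes "M > 0"
  shows "\<exists>p\<in>{0..M}. payoff pos \<beta> (P(i := p)) i > 0"
proof -
  interpret Z: market pos "P(i := 0)" r M
    using M_nonneg by (intro reprice) auto
  have "Z.f i (pos i) < Z.f k (pos i)" if "k \<in> - {i}" for k
    using that price_nonneg[of k] by (auto intro!: add_nonneg_pos)
  then obtain \<eta> where \<eta>: "\<eta> > 0"
    "\<forall>k\<in>- {i}. \<forall>x. \<bar>x - pos i\<bar> \<le> \<eta> \<longrightarrow> Z.f i x + \<eta> < Z.f k x"
    using Z.uniform_margin by metis
  define p where "p = min \<eta> M"
  have p: "0 < p" "p \<le> M" "p \<le> \<eta>"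
    using \<eta> assms by (auto simp: p_def)
  interpret N: market pos "P(i := p)" r M
    using p by (intro reprice) auto
  have "{pos i - \<eta><..<pos i + \<eta>} \<subseteq> market_region pos \<beta> (P(i := p)) i"
  proof
    fix x assume "x \<in> {pos i - \<eta><..<pos i + \<eta>}"
    then have "(x - pos i)\<^sup>2 + \<eta> < P k + (x - pos k)\<^sup>2" if "k \<noteq> i" for k
      using \<eta>(2)[rule_format, of k x] that by auto
    then show "x \<in> market_region pos \<beta> (P(i := p)) i"
      using p(3) by (force simp: market_region_iff)
  qed
  then have "market_area pos \<beta> (P(i := p)) i > 0"
    using N.market_area_ge \<eta>(1) by fastforce
  then show ?thesis
    using p by (intro bexI[of _ p]) (auto simp: payoff_def)
qed

end

section \<open>First-order conditions\<close>

text \<open>Expand, divide by \<open>e\<close> and let \<open>e\<close> tend to 0 from the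
  right.\<close>

lemma first_order_bound:
  fixes p S \<kappa> :: real
  assumes "\<And>e. 0 < e \<Longrightarrow> e < \<eta> \<Longrightarrow> (p - e) * (S + \<kappa> * e) \<le> p * S" "\<eta> > 0"
  shows "\<kappa> * p \<le> S"
proof (rule tendsto_lowerbound)
  show "((\<lambda>e. S + \<kappa> * e) \<longlongrightarrow> S) (at_right 0)"
    by (auto intro!: tendsto_eq_intros)
  show "\<forall>\<^sub>F e in at_right 0. \<kappa> * p \<le> S + \<kappa> * e"
    unfolding eventually_at_right[OF \<open>\<eta> > 0\<close>]
  proof (intro exI[of _ \<eta>] conjI allI impI)
    fix e assume e: "0 < e" "e < \<eta>"
    have "e * (\<kappa> * p) \<le> e * (S + \<kappa> * e)"
      using assms(1)[OF e] by (simp add: algebra_simps)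
    then show "\<kappa> * p \<le> S + \<kappa> * e"
      using e by simp
  qed (use assms in auto)
qed auto

text \<open>Changing the signs of both \<open>p\<close> and \<open>S\<close> turns price increases into price cuts.\<close>

lemma first_order_equality:
  fixes p S \<kappa> :: real
  assumes opt: "\<And>e. \<bar>e\<bar> < \<eta> \<Longrightarrow> (p - e) * (S + \<kappa> * e) \<le> p * S" and "\<eta> > 0"
  shows "\<kappa> * p = S"
proof (rule antisym)
  show "\<kappa> * p \<le> S"
    using assms by (rule first_order_bound[of \<eta>]) auto
  have "\<kappa> * (- p) \<le> - S"
  proof (rule first_order_bound[of \<eta>])
    fix e :: real assume "0 < e" "e < \<eta>"
    then show "(- p - e) * (- S + \<kappa> * e) \<le> - p * - S"
      using opt[of "- e"] by (simp add: algebra_simps)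
  qed fact
  then show "S \<le> \<kappa> * p"
    by simp
qed

section \<open>Prices at equilibrium\<close>

theorem theorem4:
  fixes pos :: "'k \<Rightarrow> real" and r B \<beta> :: real
  assumes distinct_positions: "inj pos"
    and locally_finite: "\<And>a b. finite {k. pos k \<in> {a..b}}"
    and relatively_dense: "\<And>x0. \<exists>k. pos k \<in> {x0 - r<..<x0 + r}"
    and "B > 0"
    and "players pos B \<noteq> {}"
    and "\<beta> \<ge> 0"
  shows "\<exists>threshold. \<forall>Pupper > threshold. \<forall>P0 P.
    (\<forall>j. j \<notin> players pos B \<longrightarrow> P0 j \<in> {0..Pupper}) \<and>
    nash_equilibrium pos \<beta> B Pupper P0 P \<longrightarrow>
    (\<forall>i \<in> players pos B. surviving pos \<beta> P i \<and>
      (\<exists>l u. left_neighbour pos \<beta> P i l \<and> right_neighbour pos \<beta> P i u \<and>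
        (no_marginal_outsider pos \<beta> B P i \<longrightarrow>
          (let d = pos u - pos i; d' = pos i - pos l
           in P i = 2 * d * d' / (d + d') * market_area pos \<beta> P i))))"
\<comment> \<open>The threshold is the one required by \<open>below_cap\<close>.\<close>
proof (intro exI[of _ "24 * r\<^sup>2"] allI impI ballI)
  fix M :: real and P0 P i
  assume M: "24 * r\<^sup>2 < M"
  assume "(\<forall>j. j \<notin> players pos B \<longrightarrow> P0 j \<in> {0..M}) \<and> nash_equilibrium pos \<beta> B M P0 P"
  then have outside: "\<And>j. j \<notin> players pos B \<Longrightarrow> P0 j \<in> {0..M}"
    and nash: "nash_equilibrium pos \<beta> B M P0 P"
    by auto
  assume i: "i \<in> players pos B"
  have price: "P k \<in> {0..M}" for k
    using nash outside[of k] unfolding nash_equilibrium_def by metis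
  interpret market pos P r M
    using assms price by unfold_locales auto
  have opt: "payoff pos \<beta> (P(j := p)) j \<le> payoff pos \<beta> P j"
    if "j \<in> players pos B" "0 \<le> p" "p \<le> M" for j p
    using nash that by (simp add: nash_equilibrium_def)
  have "0 \<le> 24 * r\<^sup>2"
    by simp
  then have "M > 0"
    using M by linarith
  have pay: "payoff pos \<beta> P j > 0" if "j \<in> players pos B" for j
    using profitable_price_exists[OF \<open>M > 0\<close>, of \<beta> j] opt[OF that] by fastforce
  have surv: "surviving pos \<beta> P j" if "j \<in> players pos B" for j
    using pay[OF that] price[of j] by (auto simp: surviving_def payoff_def zero_less_mult_iff)
  have "P i > 0"
    using pay[OF i] price[of i] by (auto simp: payoff_def zero_less_mult_iff)
  obtain l where l: "left_neighbour pos \<beta> P i l"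
    using left_neighbour_exists by blast
  obtain u where u: "right_neighbour pos \<beta> P i u"
    using right_neighbour_exists by blast
  define d where "d = pos u - pos i"
  define d' where "d' = pos i - pos l"
  have order: "pos l < pos i" "pos i < pos u"
    using l u by (auto simp: left_neighbour_def right_neighbour_def)
  then have d: "d > 0" "d' > 0"
    by (auto simp: d_def d'_def)
  obtain a b where C: "C i = {a..b}" "a < b"
    using surviving_cellE[OF surv[OF i]] by blast
  have area: "market_area pos \<beta> P i = b - a"
    using market_area_eq[OF C(1)] C(2) by simp
  have formula: "P i = 2 * d * d' / (d + d') * market_area pos \<beta> P i"
    if outsider: "no_marginal_outsider pos \<beta> B P i"
  proof -
    \<comment> \<open>Players survive by \<open>surv\<close>, outsiders by
      \<open>no_marginal_outsider\<close>.\<close>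
    have tied: "surviving pos \<beta> P k" if "x \<in> C i" "x \<in> C k" for x k
      using outsider surv that unfolding no_marginal_outsider_def owners_iff_cell by blast
    have ownl: "a \<in> C k \<longleftrightarrow> k = i \<or> k = l" for k
      using left_end_owners[OF C l] tied[of a] C by simp
    have ownu: "b \<in> C k \<longleftrightarrow> k = i \<or> k = u" for k
      using right_end_owners[OF C u] tied[of b] C by simp
    \<comment> \<open>Rate at which the bounding interval grows per unit of price cut, summed over
      both ends.\<close>
    define \<kappa> where "\<kappa> = 1 / (2 * d) + 1 / (2 * d')"
    obtain \<eta> where \<eta>: "\<eta> > 0" "\<And>e. \<bar>e\<bar> < \<eta> \<Longrightarrow>
        {a - e / (2 * d')<..<b + e / (2 * d)} \<subseteq> market_region pos \<beta> (P(i := P i - e)) i"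
      using region_after_price_cut[OF C order ownl ownu] unfolding d_def d'_def by metis
    have step: "(P i - e) * ((b - a) + \<kappa> * e) \<le> P i * (b - a)"
      if e: "\<bar>e\<bar> < \<eta>" "0 \<le> P i - e" "P i - e \<le> M" for e
    proof -
      have "(b - a) + \<kappa> * e \<le> market_area pos \<beta> (P(i := P i - e)) i"
        using market.market_area_ge[OF reprice[OF e(2,3)] \<eta>(2)[OF e(1)]]
        by (simp add: \<kappa>_def algebra_simps)
      then have "(P i - e) * ((b - a) + \<kappa> * e) \<le> payoff pos \<beta> (P(i := P i - e)) i"
        using e(2) by (simp add: payoff_def mult_left_mono)
      also have "\<dots> \<le> P i * (b - a)"
        using opt[OF i e(2,3)] by (simp add: payoff_def area)
      finally show ?thesis .
    qed
    \<comment> \<open>Only cuts are used here, since a price rise might exceed the cap.\<close>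
    have "\<kappa> * P i \<le> b - a"
    proof (rule first_order_bound)
      show "min \<eta> (P i) > 0"
        using \<eta>(1) \<open>P i > 0\<close> by simp
    qed (use step price[of i] in auto)
    \<comment> \<open>Dropping the contribution of the left end leaves the hypothesis
      \<open>foc\<close> of \<open>below_cap\<close>.\<close>
    moreover have "\<kappa> * P i \<ge> 1 / (2 * d) * P i"
      using d \<open>P i > 0\<close> by (intro mult_right_mono) (auto simp: \<kappa>_def)
    ultimately have "1 / (2 * d) * P i \<le> b - a"
      by linarith
    then have "P i \<le> 2 * d * (b - a)"
      using d by (simp add: field_simps)
    then have "P i < M"
      using C order ownu M by (intro below_cap[of i a b u]) (auto simp: d_def)
    have "\<kappa> * P i = b - a"
    proof (rule first_order_equality)
      \<comment> \<open>The last two entries keep \<open>P i - e\<close> within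
        \<open>{0..M}\<close> for either sign of \<open>e\<close>.\<close>
      show "Min {\<eta>, P i, M - P i} > 0"
        using \<eta>(1) \<open>P i > 0\<close> \<open>P i < M\<close> by simp
    qed (use step in auto)
    then show ?thesis
      using d unfolding area \<kappa>_def by (auto simp: field_simps)
  qed
  show "surviving pos \<beta> P i \<and>
      (\<exists>l u. left_neighbour pos \<beta> P i l \<and> right_neighbour pos \<beta> P i u \<and>
        (no_marginal_outsider pos \<beta> B P i \<longrightarrow>
          (let d = pos u - pos i; d' = pos i - pos l
           in P i = 2 * d * d' / (d + d') * market_area pos \<beta> P i)))"
    using surv[OF i] l u formula unfolding Let_def d_def d'_def by blast
qed

end
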